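(* Let $f\in L^2(\mathbb{R})$ be complex-valued, and let $$F(\lambda)=\int_{\mathbb{R}}\overline{f(x)}\,f(\lambda x)\,dx,\qquad \lambda\in\mathbb{R}^\times.$$ Suppose that $F$ has a holomorphic extension (also denoted $F$) to a neighborhood of $\bar{\mathbb{D}}\setminus\{i,-i\}$ such that $$\int_{\mathbb{D}}|F(\lambda)|^2\,|\lambda^2+1|\,dA(\lambda)<+\infty.$$ Then: (a) there is a constant $c_0\ge 0$ such that $F(\lambda)=c_0(1+\lambda^2)^{-1/2}$ for all $\lambda\in\mathbb{R}^\times$; and (b) if, in addition, $c_0=0$, then $F\equiv 0$ and consequently $f=0$ almost everywhere on $\mathbb{R}$.
   Context: $\mathbb{R}^\times=\mathbb{R}\setminus\{0\}$. $\mathbb{D}=\{z\in\mathbb{C}:|z|<1\}$ is the open unit disk, $\bar{\mathbb{D}}$ is its closure, and $dA$ is the area element in $\mathbb{C}$. That $F$ has a holomorphic extension to a neighborhood of $\bar{\mathbb{D}}\setminus\{i,-i\}$ means that there are an open set $U\subset\mathbb{C}$ containing $\bar{\mathbb{D}}\setminus\{i,-i\}$ and a holomorphic function on $U$ which coincides with $F$ on $U\cap\mathbb{R}^\times$. *)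

theory Defs
  imports "HOL-Complex_Analysis.Complex_Analysis"
begin

(* Membership in L^2(R), for a representative of the class. Lebesgue rather than Borel
   measurability is used, so that every representative is covered. *)
definition square_integrable :: "(real \<Rightarrow> complex) \<Rightarrow> bool" where
  "square_integrable f \<longleftrightarrow>
     f \<in> borel_measurable lebesgue \<and> integrable lebesgue (\<lambda>x. (cmod (f x))\<^sup>2)"

definition dilation_corr :: "(real \<Rightarrow> complex) \<Rightarrow> real \<Rightarrow> complex" where
  "dilation_corr f l = (LINT x|lebesgue. cnj (f x) * f (l * x))"

definition punctured_cdisk :: "complex set" where
  "punctured_cdisk = cball 0 1 - {\<i>, - \<i>}"

(* G, on the open set U, is a holomorphic extension of F to a neighborhood of S. The value
   of F at 0 is never used, since F is regarded as a function on the nonzero reals. *)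
definition holomorphic_extension ::
  "(real \<Rightarrow> complex) \<Rightarrow> complex set \<Rightarrow> complex set \<Rightarrow> (complex \<Rightarrow> complex) \<Rightarrow> bool" where
  "holomorphic_extension F S U G \<longleftrightarrow>
     open U \<and> S \<subseteq> U \<and> G holomorphic_on U \<and>
     (\<forall>l::real. l \<noteq> 0 \<longrightarrow> complex_of_real l \<in> U \<longrightarrow> G (complex_of_real l) = F l)"

end

theory Submission imports Defs begin

text \<open>
  Substituting in the integral gives F(1/l) = |l| cnj (F l) for real l. Hence
  \<Phi>(z) = F(z) (1 + z^2)^(1/2) satisfies \<Phi>(z) = cnj (\<Phi>(1 / cnj z)), first for real z and then, by the
  identity theorem, near the two open arcs into which \<i> and -\<i> divide the unit circle. So \<Phi> extends by
  reflection to the plane without \<i> and -\<i>. By hypothesis \<Phi> is square integrable over the disk, which bounds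
  it by a multiple of the inverse distance to the circle and by little-o of it at \<i> and -\<i>. This
  makes both singularities removable, and since \<Phi> is bounded near infinity, it is constant by Liouville.
\<close>

unbundle no fps_syntax

text \<open>The weight in the hypothesis is |(1 + z^2)^(1/2)|^2, so the hypothesis says that \<Phi>
  is in L^2 of the disk. The obstacle is that the resulting bound blows up along the whole circle:
  on a tangential approach to p = \<i> or p = -\<i> it gives no growth rate in |z - p|. A
  holomorphic multiplier whose modulus on a small circle about p is proportional to that of |z|^2 -
  1 repairs this. The inverse distance alone would not suffice: \<i> (p + z) / (p - z) has the same
  reflection symmetry and obeys such a bound, yet has a simple pole at p. The little-o excludes it;
  it holds because the L^2 mass of \<Phi> near p tends to 0. Each arc contains one real point, 1 or
  -1, from which the symmetry known for real arguments spreads. The constant is \<Phi>(1) = 2^(1/2)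
  F(1), and F(1) is the integral of |f|^2; this gives both the sign of the constant and the
  vanishing of f when it is 0.\<close>

section \<open>The correlation under inversion and at 1\<close>

lemma dilation_corr_inverse:
  assumes "l \<noteq> 0"
  shows "dilation_corr f (1 / l) = \<bar>l\<bar> *\<^sub>R cnj (dilation_corr f l)"
proof -
  have "dilation_corr f (1 / l) = \<bar>l\<bar> *\<^sub>R (LINT x|lebesgue. cnj (f (0 + l * x)) * f (1 / l * (0 + l * x)))"
    unfolding dilation_corr_def by (rule lebesgue_integral_real_affine[OF assms])
  also have "(LINT x|lebesgue. cnj (f (0 + l * x)) * f (1 / l * (0 + l * x)))
      = (LINT x|lebesgue. cnj (cnj (f x) * f (l * x)))"
    using assms by (simp add: mult.commute)
  also have "\<dots> = cnj (dilation_corr f l)"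
    unfolding dilation_corr_def by (rule Bochner_Integration.integral_cnj)
  finally show ?thesis .
qed

lemma dilation_corr_1: "dilation_corr f 1 = of_real (LINT x|lebesgue. (cmod (f x))\<^sup>2)"
  unfolding dilation_corr_def
  by (simp add: mult.commute complex_norm_square[symmetric] del: of_real_power)

section \<open>Rotation invariance of area in the complex plane\<close>

text \<open>Transports area from \<open>real^2\<close>, where invariance under orthogonal maps is
  available, to the complex numbers. Boxes determine the measure, and the preimage of a box is a box
  with the same side lengths.\<close>

lemma distr_lborel_vec2_Complex:
  "distr lborel borel (\<lambda>v::real^2. Complex (v $ 1) (v $ 2)) = lborel"
proof (rule lborel_eqI[symmetric])
  have eq: "(\<lambda>v::real^2. Complex (v $ 1) (v $ 2)) = (\<lambda>v. of_real (v $ 1) + \<i> * of_real (v $ 2))"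
    by (auto simp: complex_eq_iff)
  have meas: "(\<lambda>v::real^2. Complex (v $ 1) (v $ 2)) \<in> borel \<rightarrow>\<^sub>M borel"
    unfolding eq by (intro borel_measurable_continuous_onI continuous_intros)
  fix l u :: complex
  assume le: "\<And>b. b \<in> Basis \<Longrightarrow> l \<bullet> b \<le> u \<bullet> b"
  have "Re l \<le> Re u" "Im l \<le> Im u"
    using le[of 1] le[of \<i>] by (simp_all add: Basis_complex_def inner_complex_def)
  have pre: "(\<lambda>v::real^2. Complex (v $ 1) (v $ 2)) -` box l u = box (vector [Re l, Im l]) (vector [Re u, Im u])"
    by (intro set_eqI) (simp add: in_box_complex_iff mem_box_cart forall_2)
  have Basis2: "(Basis :: (real^2) set) = {axis 1 1, axis 2 1}"
    by (auto simp: Basis_vec_def UNIV_2)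
  have "emeasure (distr lborel borel (\<lambda>v::real^2. Complex (v $ 1) (v $ 2))) (box l u)
      = emeasure lborel (box (vector [Re l, Im l]) (vector [Re u, Im u]) :: (real^2) set)"
    using meas by (subst emeasure_distr) (auto simp: pre)
  also have "\<dots> = ennreal ((Re u - Re l) * (Im u - Im l))"
    using \<open>Re l \<le> Re u\<close> \<open>Im l \<le> Im u\<close>
    by (subst emeasure_lborel_box) (auto simp: Basis2 inner_axis axis_eq_axis)
  finally show "emeasure (distr lborel borel (\<lambda>v::real^2. Complex (v $ 1) (v $ 2))) (box l u)
      = ennreal (\<Prod>b\<in>Basis. (u - l) \<bullet> b)"
    by (simp add: Basis_complex_def)
qed auto

lemma orthogonal_transformation_Complex_mult:
  assumes "cmod c = 1"
  shows "orthogonal_transformation (\<lambda>v::real^2.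
           (vector [Re c * v $ 1 - Im c * v $ 2, Re c * v $ 2 + Im c * v $ 1] :: real^2))"
proof -
  have "(Re c)\<^sup>2 + (Im c)\<^sup>2 = 1"
    using assms by (metis cmod_power2 one_power2)
  then have 1: "(Re c * x - Im c * y)\<^sup>2 + (Re c * y + Im c * x)\<^sup>2 = x\<^sup>2 + y\<^sup>2" for x y
    by algebra
  show ?thesis
    unfolding orthogonal_transformation
  proof (intro conjI allI)
    show "linear (\<lambda>v::real^2. (vector [Re c * v $ 1 - Im c * v $ 2, Re c * v $ 2 + Im c * v $ 1] :: real^2))"
      by (rule linearI) (simp_all add: vec_eq_iff forall_2 ring_distribs)
    show "norm (vector [Re c * v $ 1 - Im c * v $ 2, Re c * v $ 2 + Im c * v $ 1] :: real^2) = norm v" for v :: "real^2"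
      by (simp add: norm_vec_def L2_set_def sum_2 1)
  qed
qed

text \<open>The coordinate map \<open>\<psi>\<close> turns multiplication by c into the rotation
  \<open>T c\<close> of \<open>real^2\<close>, whose inverse is \<open>T (cnj c)\<close>. This
  writes preimages as images, the form in which orthogonal invariance applies.\<close>

lemma distr_lborel_complex_mult:
  fixes c :: complex
  assumes c: "cmod c = 1"
  shows "distr lborel borel ((*) c) = lborel"
proof (rule lborel_eqI[symmetric])
  define \<psi> where "\<psi> = (\<lambda>v::real^2. Complex (v $ 1) (v $ 2))"
  define T :: "complex \<Rightarrow> real^2 \<Rightarrow> real^2" where
    "T = (\<lambda>c v. vector [Re c * v $ 1 - Im c * v $ 2, Re c * v $ 2 + Im c * v $ 1])"
  have orth: "orthogonal_transformation (T d)" if "cmod d = 1" for d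
    unfolding T_def by (rule orthogonal_transformation_Complex_mult[OF that])
  have \<psi>T: "\<psi> (T d v) = d * \<psi> v" for d v
    by (simp add: \<psi>_def T_def complex_eq_iff)
  have \<psi>: "\<psi> \<in> borel \<rightarrow>\<^sub>M borel"
  proof -
    have "\<psi> = (\<lambda>v. of_real (v $ 1) + \<i> * of_real (v $ 2))"
      by (auto simp: complex_eq_iff \<psi>_def)
    then show ?thesis
      by (auto intro!: borel_measurable_continuous_onI continuous_intros)
  qed
  have \<psi>_inj: "\<psi> v = \<psi> w \<longleftrightarrow> v = w" for v w
    by (auto simp: \<psi>_def vec_eq_iff forall_2)
  have em: "emeasure lborel A = emeasure lborel (\<psi> -` A)" if "A \<in> sets borel" for A
    by (subst distr_lborel_vec2_Complex[symmetric], fold \<psi>_def, subst emeasure_distr) (use that \<psi> in auto)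
  fix l u :: complex
  assume le: "\<And>b. b \<in> Basis \<Longrightarrow> l \<bullet> b \<le> u \<bullet> b"
  have cc: "c * cnj c = 1" using c by (simp add: complex_norm_square[symmetric])
  have mc: "(*) c \<in> borel \<rightarrow>\<^sub>M borel"
    by (intro borel_measurable_continuous_onI continuous_intros)
  have mem: "(*) c -` box l u \<in> sets borel"
    using measurable_sets[OF mc, of "box l u"] by simp
  have pre: "\<psi> -` (*) c -` box l u = T (cnj c) ` (\<psi> -` box l u)"
  proof -
    have 1: "\<psi> (T c (T (cnj c) v)) = \<psi> v" "\<psi> (T (cnj c) (T c v)) = \<psi> v" for v
      using cc by (auto simp: \<psi>T mult.assoc[symmetric] mult.commute)
    then have TT: "T c (T (cnj c) v) = v" "T (cnj c) (T c v) = v" for v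
      by (auto simp: \<psi>_inj)
    show ?thesis
    proof (intro equalityI subsetI)
      fix v assume "v \<in> \<psi> -` (*) c -` box l u"
      then have "T c v \<in> \<psi> -` box l u" by (simp add: \<psi>T)
      then show "v \<in> T (cnj c) ` (\<psi> -` box l u)" using TT by (metis imageI)
    next
      fix v assume "v \<in> T (cnj c) ` (\<psi> -` box l u)"
      then obtain w where "w \<in> \<psi> -` box l u" "v = T (cnj c) w" by blast
      then show "v \<in> \<psi> -` (*) c -` box l u" using TT by (simp add: \<psi>T[symmetric])
    qed
  qed
  have S: "\<psi> -` box l u \<in> sets borel"
    using measurable_sets[OF \<psi>, of "box l u"] by simp
  have fin: "emeasure lborel (\<psi> -` box l u) < \<infinity>"
    by (subst em[symmetric]) (auto simp: emeasure_lborel_box_eq)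
  have S': "\<psi> -` box l u \<in> lmeasurable"
    using S fin by (auto simp: fmeasurable_def)
  have "emeasure (distr lborel borel ((*) c)) (box l u) = emeasure lborel ((*) c -` box l u)"
    using mc by (subst emeasure_distr) auto
  also have "\<dots> = emeasure lborel (\<psi> -` (*) c -` box l u)"
    by (rule em[OF mem])
  also have "\<dots> = emeasure lebesgue (\<psi> -` (*) c -` box l u)"
    using measurable_sets[OF \<psi>, of "(*) c -` box l u"] mem by simp
  also have "\<dots> = emeasure lebesgue (\<psi> -` box l u)"
    unfolding pre
    using measurable_orthogonal_image[OF orth S', of "cnj c"] measure_orthogonal_image[OF orth S', of "cnj c"] S' c
    by (simp add: emeasure_eq_measure2)
  also have "\<dots> = emeasure lborel (\<psi> -` box l u)"
    using S by simp
  also have "\<dots> = emeasure lborel (box l u)"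
    by (rule em[symmetric]) simp
  also have "\<dots> = ennreal (\<Prod>b\<in>Basis. (u - l) \<bullet> b)"
    using le by (simp add: emeasure_lborel_box)
  finally show "emeasure (distr lborel borel ((*) c)) (box l u) = ennreal (\<Prod>b\<in>Basis. (u - l) \<bullet> b)" .
qed auto

section \<open>Mean value inequalities on circles and disks\<close>

text \<open>Cauchy's formula at the centre, divided by 2 pi \<i>, is an average over t in [0,1] of
  total weight one; the triangle inequality does the rest. The \<open>ennreal\<close> form is the
  one to be integrated over a second variable.\<close>

lemma norm_center_le_circle_mean:
  assumes "h holomorphic_on cball 0 1"
  shows "ennreal (cmod (h 0)) \<le> (\<integral>\<^sup>+t\<in>{0..1}. ennreal (cmod (h (cis (2 * pi * t)))) \<partial>lborel)"
proof -
  have "((\<lambda>u. h u / (u - 0)) has_contour_integral (2 * of_real pi * \<i> * h 0)) (circlepath 0 1)"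
    using assms by (rule Cauchy_integral_circlepath_simple) auto
  then have "((\<lambda>t. h (circlepath 0 1 t) / circlepath 0 1 t * vector_derivative (circlepath 0 1) (at t))
      has_integral (2 * of_real pi * \<i> * h 0)) {0..1}"
    by (simp add: has_contour_integral)
  also have "(\<lambda>t. h (circlepath 0 1 t) / circlepath 0 1 t * vector_derivative (circlepath 0 1) (at t))
      = (\<lambda>t. (2 * of_real pi * \<i>) * h (cis (2 * pi * t)))"
    unfolding vector_derivative_circlepath by (intro ext) (simp add: circlepath cis_conv_exp mult_ac)
  finally have "((\<lambda>t. (2 * of_real pi * \<i>) * h (cis (2 * pi * t))) has_integral (2 * of_real pi * \<i> * h 0)) {0..1}" .
  moreover define K where "K = 2 * of_real pi * \<i>"
  ultimately have K: "((\<lambda>t. K * h (cis (2 * pi * t))) has_integral K * h 0) {0..1}"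
    by simp
  have "K \<noteq> 0" by (simp add: K_def)
  from has_integral_mult_right[OF K, of "inverse K"]
  have int: "((\<lambda>t. h (cis (2 * pi * t))) has_integral h 0) {0..1}"
    using \<open>K \<noteq> 0\<close> by (simp add: mult.assoc[symmetric])
  have "continuous_on {0..1} (\<lambda>t. h (cis (2 * pi * t)))"
    by (intro continuous_on_compose2[OF holomorphic_on_imp_continuous_on[OF assms]] continuous_intros) auto
  then have nint: "(\<lambda>t. cmod (h (cis (2 * pi * t)))) integrable_on {0..1}"
    by (intro integrable_continuous_real continuous_on_norm)
  have "cmod (h 0) \<le> integral {0..1} (\<lambda>t. cmod (h (cis (2 * pi * t))))"
    using int nint by (metis has_integral_integrable_integral integral_norm_bound_integral order_refl)
  moreover have "(\<integral>\<^sup>+t\<in>{0..1}. ennreal (cmod (h (cis (2 * pi * t)))) \<partial>lborel)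
      = ennreal (integral {0..1} (\<lambda>t. cmod (h (cis (2 * pi * t)))))"
    using nint by (intro nn_integral_has_integral_lebesgue' integrable_integral) auto
  ultimately show ?thesis
    by (simp add: ennreal_leI)
qed

text \<open>Averaging over rotations of the ball about its centre avoids polar coordinates.\<close>
lemma square_norm_center_le_area_mean:
  assumes hol: "g holomorphic_on ball z r" and "r > 0"
  shows "ennreal (pi * r\<^sup>2 * (cmod (g z))\<^sup>2) \<le> (\<integral>\<^sup>+w\<in>ball z r. ennreal ((cmod (g w))\<^sup>2) \<partial>lborel)"
proof -
  \<comment> \<open>Moving the centre to 0 and extending by zero gives a function on the whole
    plane, on which rotations act.\<close>
  define u where "u w = ennreal ((cmod (g (z + w)))\<^sup>2) * indicator (ball 0 r) w" for w
  have "continuous_on (ball 0 r) (\<lambda>w. (cmod (g (z + w)))\<^sup>2)"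
    by (intro continuous_intros continuous_on_compose2[OF holomorphic_on_imp_continuous_on[OF hol]])
       (auto simp: dist_norm)
  then have "(\<lambda>w. indicator (ball 0 r) w *\<^sub>R (cmod (g (z + w)))\<^sup>2) \<in> borel_measurable borel"
    by (intro borel_measurable_continuous_on_indicator) auto
  then have "(\<lambda>w. ennreal (indicator (ball 0 r) w *\<^sub>R (cmod (g (z + w)))\<^sup>2)) \<in> borel_measurable borel"
    by measurable
  also have "(\<lambda>w. ennreal (indicator (ball 0 r) w *\<^sub>R (cmod (g (z + w)))\<^sup>2)) = u"
    by (auto simp: u_def fun_eq_iff indicator_def)
  finally have u [measurable]: "u \<in> borel_measurable borel" .
  have rot: "(\<integral>\<^sup>+w. u (c * w) \<partial>lborel) = (\<integral>\<^sup>+w. u w \<partial>lborel)" if "cmod c = 1" for c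
    by (subst (2) distr_lborel_complex_mult[OF that, symmetric], subst nn_integral_distr) auto
  have "(\<integral>\<^sup>+w\<in>ball z r. ennreal ((cmod (g w))\<^sup>2) \<partial>lborel) = (\<integral>\<^sup>+w. u (w - z) \<partial>lborel)"
    by (intro nn_integral_cong) (auto simp: u_def indicator_def dist_norm norm_minus_commute)
  also have "\<dots> = (\<integral>\<^sup>+w. u w \<partial>lborel)"
    by (subst lborel_distr_plus[of z, symmetric], subst nn_integral_distr) auto
  \<comment> \<open>Averaging over t in [0,1] changes nothing, because every rotated copy of
    \<open>u\<close> has the same integral. Exchanging the two integrals then leaves circle means
    inside.\<close>
  also have "\<dots> = (\<integral>\<^sup>+t. (\<integral>\<^sup>+w. u w \<partial>lborel) * indicator {0..1::real} t \<partial>lborel)"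
    by (subst nn_integral_cmult_indicator) auto
  also have "\<dots> = (\<integral>\<^sup>+t. (\<integral>\<^sup>+w. u (cis (2 * pi * t) * w) * indicator {0..1} t \<partial>lborel) \<partial>lborel)"
    by (intro nn_integral_cong) (simp add: nn_integral_multc rot)
  also have "\<dots> = (\<integral>\<^sup>+w. (\<integral>\<^sup>+t. u (cis (2 * pi * t) * w) * indicator {0..1} t \<partial>lborel) \<partial>lborel)"
  proof (rule lborel_pair.Fubini')
    have [measurable]: "(\<lambda>t. cis (2 * pi * t)) \<in> borel_measurable borel"
      by (intro borel_measurable_continuous_onI continuous_intros)
    show "(\<lambda>(w, t). u (cis (2 * pi * t) * w) * indicator {0..1} t) \<in> borel_measurable (lborel \<Otimes>\<^sub>M lborel)"
      by measurable
  qed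
  also have "\<dots> \<ge> (\<integral>\<^sup>+w. ennreal ((cmod (g z))\<^sup>2) * indicator (ball (0::complex) r) w \<partial>lborel)"
  proof (intro nn_integral_mono)
    fix w :: complex
    show "ennreal ((cmod (g z))\<^sup>2) * indicator (ball 0 r) w
        \<le> (\<integral>\<^sup>+t. u (cis (2 * pi * t) * w) * indicator {0..1} t \<partial>lborel)"
    proof (cases "w \<in> ball 0 r")
      case True
      \<comment> \<open>For fixed w the unit circle parametrises the circle through z + w about z.
        The mean value inequality is applied to g^2, whose modulus is the integrand |g|^2.\<close>
      have "(\<lambda>\<zeta>. (g (z + \<zeta> * w))\<^sup>2) holomorphic_on cball 0 1"
      proof (intro holomorphic_intros holomorphic_on_compose_gen[OF _ hol, unfolded o_def])
        show "(\<lambda>\<zeta>. z + \<zeta> * w) ` cball 0 1 \<subseteq> ball z r"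
        proof (clarsimp simp: dist_norm norm_mult)
          fix \<zeta> :: complex assume "cmod \<zeta> \<le> 1"
          then have "cmod \<zeta> * cmod w \<le> 1 * cmod w" by (intro mult_right_mono) auto
          then show "cmod \<zeta> * cmod w < r" using True by simp
        qed
      qed
      from norm_center_le_circle_mean[OF this]
      have "ennreal ((cmod (g z))\<^sup>2)
          \<le> (\<integral>\<^sup>+t\<in>{0..1}. ennreal ((cmod (g (z + cis (2 * pi * t) * w)))\<^sup>2) \<partial>lborel)"
        by (simp add: norm_power)
      also have "\<dots> = (\<integral>\<^sup>+t. u (cis (2 * pi * t) * w) * indicator {0..1} t \<partial>lborel)"
        using True by (intro nn_integral_cong) (simp add: u_def norm_mult)
      finally show ?thesis using True by simp
    qed auto
  qed
  also have "(\<integral>\<^sup>+w. ennreal ((cmod (g z))\<^sup>2) * indicator (ball (0::complex) r) w \<partial>lborel)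
      = ennreal (pi * r\<^sup>2 * (cmod (g z))\<^sup>2)"
    using \<open>r > 0\<close>
    by (subst nn_integral_cmult_indicator)
       (auto simp: emeasure_ball unit_ball_vol_2 ennreal_mult[symmetric] mult_ac)
  finally show ?thesis .
qed

section \<open>Removing a singularity on the unit circle\<close>

text \<open>The bound says nothing on the unit circle itself, but it still caps the pole at p at
  order two. The radial condition then removes both orders, one at a time, since a function
  continuous at p has its value there fixed by the limit along one radius. The conclusion is
  Riemann's criterion for removability.\<close>

lemma removable_singularity_unit_circle:
  fixes g :: "complex \<Rightarrow> complex"
  assumes p: "cmod p = 1" and "\<rho> > 0"
    and hol: "g holomorphic_on ball p \<rho> - {p}"
    and bound: "\<And>z. z \<in> ball p \<rho> - {p} \<Longrightarrow> cmod (g z) * \<bar>(cmod z)\<^sup>2 - 1\<bar> \<le> C"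
    and radial: "((\<lambda>r. (1 - r) * cmod (g (of_real r * p))) \<longlongrightarrow> 0) (at_left 1)"
  shows "((\<lambda>z. (z - p) * g z) \<longlongrightarrow> 0) (at p)"
proof -
  \<comment> \<open>R < \<rho> keeps the outer circle inside the domain, and R \<le> 1 makes each of
    the three terms of \<open>Q r\<close> at most 1 in modulus there.\<close>
  define R where "R = min (\<rho> / 2) 1"
  have R: "R > 0" "R \<le> 1" "R < \<rho>"
    using \<open>\<rho> > 0\<close> by (auto simp: R_def)
  \<comment> \<open>On the circle of radius r about p, the factor |z|^2 - 1, which vanishes where that circle meets
    the unit circle, has the modulus of the polynomial Q r / r. So the maximum principle bounds
    g Q r on an annulus, uniformly in r, and Q r tends to cnj p (z - p)^2.\<close>
  define Q where "Q r z = cnj p * (z - p)\<^sup>2 + of_real (r\<^sup>2) * (z - p) + p * of_real (r\<^sup>2)" for r z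
  have pp: "p * cnj p = 1"
    using p by (simp add: complex_norm_square[symmetric])
  have Q_circle: "cmod (Q r z) = r * \<bar>(cmod z)\<^sup>2 - 1\<bar>" if "cmod (z - p) = r" for r z
  proof -
    define w where "w = z - p"
    have z: "z = p + w" by (simp add: w_def)
    \<comment> \<open>On |w| = r the constant r^2 equals w cnj w, which turns the polynomial
      \<open>Q r\<close> into w (|z|^2 - 1).\<close>
    have r: "of_real (r\<^sup>2) = w * cnj w"
      using that unfolding w_def by (simp only: complex_norm_square[symmetric])
    have "of_real ((cmod z)\<^sup>2 - 1) = z * cnj z - p * cnj p"
      using pp by (simp only: of_real_diff complex_norm_square of_real_1)
    then have "Q r z = w * of_real ((cmod z)\<^sup>2 - 1)"
      unfolding Q_def r w_def[symmetric] by (simp only: z) (simp add: algebra_simps power2_eq_square)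
    then show ?thesis
      using that by (simp only: norm_mult norm_of_real w_def)
  qed
  obtain M where M: "M \<ge> 0" "\<And>z. z \<in> sphere p R \<Longrightarrow> cmod (g z) \<le> M"
  proof -
    have "continuous_on (sphere p R) g"
      by (rule holomorphic_on_imp_continuous_on, rule holomorphic_on_subset[OF hol])
         (use R in auto)
    then have "bounded (g ` sphere p R)"
      by (intro compact_imp_bounded compact_continuous_image) auto
    then obtain M where "M > 0" "\<And>z. z \<in> sphere p R \<Longrightarrow> cmod (g z) \<le> M"
      unfolding bounded_pos by auto
    then show ?thesis by (intro that[of M]) auto
  qed
  have C0: "C \<ge> 0"
  proof -
    have "p + of_real R \<in> ball p \<rho> - {p}"
      using R by (auto simp: dist_norm)
    from bound[OF this] show ?thesis
      by (rule order_trans[rotated]) auto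
  qed
  \<comment> \<open>C serves the inner circle, where |g Q| is r times the bounded quantity and r
    \<le> 1; 3 * M serves the outer circle, where |Q| \<le> 3.\<close>
  define K where "K = max C (3 * M)"
  have annulus: "cmod (g z * Q r z) \<le> K" if r: "0 < r" "r \<le> cmod (z - p)" "cmod (z - p) \<le> R" for r z
  proof (rule maximum_modulus_frontier[where S = "cball p R - ball p r" and f = "\<lambda>z. g z * Q r z"])
    have sub: "cball p R - ball p r \<subseteq> ball p \<rho> - {p}"
      using R r by auto
    have clo: "closed (cball p R - ball p r)"
      by (intro closed_Diff) auto
    have hol': "(\<lambda>z. g z * Q r z) holomorphic_on cball p R - ball p r"
      unfolding Q_def by (intro holomorphic_intros holomorphic_on_subset[OF hol] sub)
    show "(\<lambda>z. g z * Q r z) holomorphic_on interior (cball p R - ball p r)"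
      by (rule holomorphic_on_subset[OF hol' interior_subset])
    show "continuous_on (closure (cball p R - ball p r)) (\<lambda>z. g z * Q r z)"
      using holomorphic_on_imp_continuous_on[OF hol'] clo by simp
    show "bounded (cball p R - ball p r)"
      by (rule bounded_subset[of "cball p R"]) auto
    show "z \<in> cball p R - ball p r"
      using r by (auto simp: dist_norm norm_minus_commute)
    fix z assume "z \<in> frontier (cball p R - ball p r)"
    moreover have "ball p R - cball p r \<subseteq> interior (cball p R - ball p r)"
      by (rule interior_maximal) (auto intro: open_Diff)
    ultimately have "z \<in> cball p R - ball p r" "z \<notin> ball p R - cball p r"
      using clo by (auto simp: frontier_def)
    then consider "cmod (z - p) = R" | "cmod (z - p) = r"
      by (force simp: dist_norm norm_minus_commute)
    then show "cmod (g z * Q r z) \<le> K"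
    proof cases
      case 1
      have r1: "r \<le> 1" "r\<^sup>2 \<le> 1" "R\<^sup>2 \<le> 1" using r R by (auto simp: power_le_one)
      have "cmod (Q r z) \<le> cmod (cnj p * (z - p)\<^sup>2) + cmod (of_real (r\<^sup>2) * (z - p)) + cmod (p * of_real (r\<^sup>2))"
        unfolding Q_def by (intro norm_triangle_le add_mono order_refl)
      also have "\<dots> = R\<^sup>2 + r\<^sup>2 * R + r\<^sup>2"
        using p 1 by (simp add: norm_mult norm_power)
      also have "\<dots> \<le> 1 + 1 * 1 + 1"
        using r1 R by (intro add_mono mult_mono) auto
      finally have "cmod (g z) * cmod (Q r z) \<le> M * 3"
        using M 1 by (intro mult_mono) (auto simp: dist_norm norm_minus_commute)
      then show ?thesis by (simp add: K_def norm_mult)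
    next
      case 2
      have "cmod (g z * Q r z) = r * (cmod (g z) * \<bar>(cmod z)\<^sup>2 - 1\<bar>)"
        by (simp add: norm_mult Q_circle[OF 2])
      also have "\<dots> \<le> 1 * C"
        using r R C0 2 by (intro mult_mono bound) (auto simp: dist_norm norm_minus_commute)
      finally show ?thesis by (simp add: K_def)
    qed
  qed
  have k_bound: "cmod ((z - p)\<^sup>2 * g z) \<le> K" if z: "z \<in> ball p R - {p}" for z
  proof -
    have "((\<lambda>r. cmod (g z * Q r z)) \<longlongrightarrow> cmod (g z * Q 0 z)) (at_right 0)"
      unfolding Q_def by (intro tendsto_intros)
    moreover have "\<forall>\<^sub>F r in at_right 0. cmod (g z * Q r z) \<le> K"
      unfolding eventually_at_right_field
      using z by (intro exI[of _ "cmod (z - p)"]) (auto intro!: annulus simp: dist_norm norm_minus_commute)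
    ultimately have "cmod (g z * Q 0 z) \<le> K"
      by (rule tendsto_upperbound) simp
    then show ?thesis
      using p by (simp add: Q_def norm_mult norm_power mult.commute)
  qed
  have "\<exists>h. h holomorphic_on ball p R \<and> (\<forall>z\<in>ball p R - {p}. h z = (z - p)\<^sup>2 * g z)"
  proof (subst holomorphic_on_extend_bounded)
    show "(\<lambda>z. (z - p)\<^sup>2 * g z) holomorphic_on ball p R - {p}"
      by (intro holomorphic_intros holomorphic_on_subset[OF hol]) (use R in auto)
    show "\<exists>B. \<forall>\<^sub>F z in at p. cmod ((z - p)\<^sup>2 * g z) \<le> B"
      using R k_bound by (intro exI[of _ K]) (auto simp: eventually_at dist_commute intro!: exI[of _ R])
  qed (use R in auto)
  then obtain h where h: "h holomorphic_on ball p R" "\<And>z. z \<in> ball p R - {p} \<Longrightarrow> h z = (z - p)\<^sup>2 * g z"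
    by blast
  have "p \<noteq> 0" using p by auto
  have path: "filterlim (\<lambda>r. of_real r * p) (at p) (at_left (1::real))"
    unfolding filterlim_at
  proof
    have "((\<lambda>r. of_real r * p) \<longlongrightarrow> of_real 1 * p) (at_left 1)"
      by (intro tendsto_intros)
    then show "((\<lambda>r. of_real r * p) \<longlongrightarrow> p) (at_left 1)" by simp
    have "of_real r * p \<noteq> p" if "r < 1" for r :: real
      using \<open>p \<noteq> 0\<close> that by auto
    then show "\<forall>\<^sub>F r in at_left 1. of_real r * p \<in> UNIV \<and> of_real r * p \<noteq> p"
      unfolding eventually_at_left_field by (intro exI[of _ 0]) auto
  qed
  have ev: "\<forall>\<^sub>F r in at_left (1::real). of_real r * p \<in> ball p R - {p}"
    using filterlim_iff[THEN iffD1, OF path, rule_format, of "\<lambda>z. z \<in> ball p R - {p}"] R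
    by (auto simp: eventually_at dist_commute intro: exI[of _ R])
  have nrm: "cmod (of_real r * p - p) = 1 - r" if "r < 1" for r
  proof -
    have "of_real r * p - p = - (of_real (1 - r) * p)" by (simp add: algebra_simps)
    then show ?thesis using that p by (simp only: norm_minus_cancel norm_mult norm_of_real) auto
  qed
  have ev_less: "\<forall>\<^sub>F r in at_left (1::real). r < 1"
    by (simp add: eventually_at_filter)
  have ev_pos: "\<forall>\<^sub>F r in at_left (1::real). r > 0"
    unfolding eventually_at_left_field by (intro exI[of _ 0]) auto
  \<comment> \<open>Used for the extension of (z - p)^2 g and then for that of (z - p) g; on the
    radius |z - p| = 1 - r, so both are dominated by the quantity that tends to 0.\<close>
  have vanish: "H p = 0" if "H holomorphic_on ball p R"
    and "\<forall>\<^sub>F r in at_left (1::real). cmod (H (of_real r * p)) \<le> (1 - r) * cmod (g (of_real r * p))" for H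
  proof -
    have "continuous_on (ball p R) H"
      using that(1) by (rule holomorphic_on_imp_continuous_on)
    then have "isCont H p"
      using R by (simp add: continuous_on_eq_continuous_at)
    then have "(H \<longlongrightarrow> H p) (at p)" by (simp add: isCont_def)
    then have "((\<lambda>r. H (of_real r * p)) \<longlongrightarrow> H p) (at_left (1::real))"
      using path by (rule filterlim_compose)
    moreover have "((\<lambda>r. H (of_real r * p)) \<longlongrightarrow> 0) (at_left (1::real))"
      by (rule Lim_null_comparison[OF that(2) radial])
    ultimately show ?thesis
      by (intro tendsto_unique) auto
  qed
  have hp: "h p = 0"
  proof (rule vanish[OF h(1)])
    show "\<forall>\<^sub>F r in at_left (1::real). cmod (h (of_real r * p)) \<le> (1 - r) * cmod (g (of_real r * p))"
      using ev ev_less ev_pos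
    proof (eventually_elim)
      case (elim r)
      have "cmod (h (of_real r * p)) = (1 - r)\<^sup>2 * cmod (g (of_real r * p))"
        using h(2)[of "of_real r * p"] elim nrm[of r] by (simp add: norm_mult norm_power)
      also have "\<dots> \<le> (1 - r) * cmod (g (of_real r * p))"
        using elim by (intro mult_right_mono) (auto simp: power2_eq_square mult_le_cancel_left1)
      finally show ?case .
    qed
  qed
  \<comment> \<open>The difference quotient of h at p. As h vanishes there, it is the extension of
    (z - p) g across p.\<close>
  define h1 where "h1 z = (if z = p then deriv h p else (h z - h p) / (z - p))" for z
  have h1: "h1 holomorphic_on ball p R"
    unfolding h1_def by (rule pole_lemma_open[OF h(1)]) auto
  have h1_eq: "h1 z = (z - p) * g z" if "z \<in> ball p R - {p}" for z
    using that h(2)[OF that] by (auto simp: h1_def hp power2_eq_square)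
  have "h1 p = 0"
  proof (rule vanish[OF h1])
    show "\<forall>\<^sub>F r in at_left (1::real). cmod (h1 (of_real r * p)) \<le> (1 - r) * cmod (g (of_real r * p))"
      using ev ev_less by eventually_elim (simp only: h1_eq norm_mult nrm)
  qed
  moreover have "(h1 \<longlongrightarrow> h1 p) (at p)"
  proof -
    have "continuous_on (ball p R) h1"
      using h1 by (rule holomorphic_on_imp_continuous_on)
    then show ?thesis
      using R by (simp add: continuous_on_eq_continuous_at isCont_def[symmetric])
  qed
  ultimately have "(h1 \<longlongrightarrow> 0) (at p)" by simp
  then show ?thesis
    by (rule Lim_transform_within[OF _ \<open>R > 0\<close>]) (auto simp: h1_eq dist_commute)
qed

section \<open>Reflection across the two arcs of the unit circle\<close>

lemma inverse_cnj_unit: "cmod z = 1 \<Longrightarrow> inverse (cnj z) = z"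
  by (metis complex_cnj_cnj complex_cnj_inverse complex_norm_square inverse_unique mult.commute of_real_1 one_power2)

text \<open>The arc is the radial projection, under \<open>sgn\<close>, of an open half-plane, which
  is convex. The sign of e chooses the right or the left arc.\<close>

lemma connected_open_half_circle:
  fixes e :: real
  assumes "e \<noteq> 0"
  shows "connected {z. cmod z = 1 \<and> 0 < e * Re z}"
proof -
  have eq: "{z. cmod z = 1 \<and> 0 < e * Re z} = sgn ` {z. 0 < e * Re z}"
  proof (intro equalityI subsetI)
    fix z assume z: "z \<in> {z. cmod z = 1 \<and> 0 < e * Re z}"
    then have "z = sgn z" by (simp add: sgn_eq)
    then show "z \<in> sgn ` {z. 0 < e * Re z}" using z by (intro image_eqI[of _ _ z]) auto
  next
    fix z assume "z \<in> sgn ` {z. 0 < e * Re z}"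
    then obtain w where w: "0 < e * Re w" "z = sgn w" by auto
    then have "w \<noteq> 0" by auto
    then have "0 < e * Re w / cmod w" using w by simp
    then show "z \<in> {z. cmod z = 1 \<and> 0 < e * Re z}"
      using \<open>w \<noteq> 0\<close> by (simp add: w(2) sgn_eq norm_divide)
  qed
  have "{z. 0 < e * Re z} = {z. of_real e \<bullet> z > 0}"
    by (simp add: inner_complex_def)
  then have "convex {z. 0 < e * Re z}"
    by (simp only: convex_halfspace_gt)
  moreover have "continuous_on {z. 0 < e * Re z} (sgn :: complex \<Rightarrow> complex)"
    by (intro continuous_on_sgn continuous_intros) auto
  ultimately show ?thesis
    unfolding eq by (intro connected_continuous_image convex_connected)
qed

text \<open>W need not be connected or symmetric, so the identity theorem is applied on a component
  of the set where both w and its reflection lie in W. The reflection fixes A pointwise and A is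
  connected, so A lies in the component of e. As e is 1 or -1, it is a limit of real points of that
  component, where \<open>sym\<close> applies.\<close>

lemma reflection_identity_near_arc:
  assumes "open W" and hol: "\<Phi> holomorphic_on W"
    and sym: "\<And>l::real. l \<noteq> 0 \<Longrightarrow> of_real l \<in> W \<Longrightarrow> of_real (1 / l) \<in> W \<Longrightarrow>
                \<Phi> (of_real (1 / l)) = cnj (\<Phi> (of_real l))"
    and A: "connected A" "A \<subseteq> sphere 0 1 \<inter> W" "of_real e \<in> A" and z: "z \<in> A"
  obtains \<epsilon> where "\<epsilon> > 0" "ball z \<epsilon> \<subseteq> W" "\<And>w. w \<in> ball z \<epsilon> \<Longrightarrow> \<Phi> w = cnj (\<Phi> (inverse (cnj w)))"
proof -
  \<comment> \<open>0 is left out because the reflection is discontinuous there.\<close>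
  define S where "S = (W - {0}) \<inter> (\<lambda>w. inverse (cnj w)) -` W"
  have "open S"
    unfolding S_def by (intro continuous_open_preimage continuous_intros open_Diff \<open>open W\<close>) auto
  have AS: "A \<subseteq> S"
    using A(2) inverse_cnj_unit by (fastforce simp: S_def)
  define C where "C = connected_component_set S (of_real e)"
  have C: "open C" "connected C" "C \<subseteq> S" "A \<subseteq> C"
    unfolding C_def using \<open>open S\<close> A AS
    by (simp_all add: open_connected_component connected_component_maximal connected_component_subset)
  have K: "(\<lambda>w. cnj (\<Phi> (inverse (cnj w)))) holomorphic_on S"
  proof -
    have "(\<Phi> \<circ> inverse) holomorphic_on cnj ` S"
      by (intro holomorphic_on_compose_gen[OF _ hol] holomorphic_intros) (auto simp: S_def)
    from holomorphic_on_compose_cnj_cnj[OF this \<open>open S\<close>] show ?thesis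
      by (simp add: o_def)
  qed
  have eq: "\<Phi> w - cnj (\<Phi> (inverse (cnj w))) = 0" if "w \<in> C" for w
  proof (rule analytic_continuation[where f = "\<lambda>w. \<Phi> w - cnj (\<Phi> (inverse (cnj w)))" and w = w and S = C and U = "C \<inter> \<real>" and \<xi> = "of_real e"])
    show "(\<lambda>w. \<Phi> w - cnj (\<Phi> (inverse (cnj w)))) holomorphic_on C"
      using C(3) by (intro holomorphic_intros holomorphic_on_subset[OF hol] holomorphic_on_subset[OF K])
                    (auto simp: S_def)
    show eC: "of_real e \<in> C" using C A by auto
    show "of_real e islimpt C \<inter> \<real>"
      unfolding islimpt_approachable
    proof (intro allI impI)
      fix \<delta> :: real assume "\<delta> > 0"
      obtain \<eta> where \<eta>: "\<eta> > 0" "ball (of_real e) \<eta> \<subseteq> C"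
        using eC C(1) open_contains_ball by blast
      have d: "dist (of_real (e + t)) (complex_of_real e) = \<bar>t\<bar>" for t
        by (simp add: dist_norm)
      show "\<exists>x'\<in>C \<inter> \<real>. x' \<noteq> of_real e \<and> dist x' (of_real e) < \<delta>"
        using \<eta> \<open>\<delta> > 0\<close> d[of "min \<delta> \<eta> / 2"]
        \<comment> \<open>Half of the smaller radius stays strictly inside both the ball of radius
          \<delta> and the one contained in \<open>C\<close>.\<close>
        by (intro bexI[of _ "of_real (e + min \<delta> \<eta> / 2)"])
           (auto simp del: of_real_add simp: dist_commute min_def split: if_splits)
    qed
    fix u assume u: "u \<in> C \<inter> \<real>"
    then obtain l where l: "u = of_real l" by (auto elim: Reals_cases)
    have inv: "inverse (cnj u) = of_real (1 / l)"
      by (simp add: l divide_inverse)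
    have "u \<in> S" using u C(3) by auto
    then have "l \<noteq> 0" "of_real l \<in> W" "of_real (1 / l) \<in> W"
      using inv unfolding S_def l by auto
    from sym[OF this] show "\<Phi> u - cnj (\<Phi> (inverse (cnj u))) = 0"
      unfolding inv by (simp add: l)
  qed (use that C in auto)
  obtain \<epsilon> where \<epsilon>: "\<epsilon> > 0" "ball z \<epsilon> \<subseteq> C"
    using C z open_contains_ball by blast
  show thesis
  proof (rule that)
    show "ball z \<epsilon> \<subseteq> W" using \<epsilon>(2) C(3) by (auto simp: S_def)
    show "\<Phi> w = cnj (\<Phi> (inverse (cnj w)))" if "w \<in> ball z \<epsilon>" for w
      using eq[of w] \<epsilon>(2) that by auto
  qed (fact \<epsilon>(1))
qed

section \<open>Constancy of a square integrable function with reflection symmetry\<close>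

text \<open>This part is free of f, which enters only through the symmetry at real points and the
  integrability. As W may be far from symmetric, the extension \<open>E\<close> is glued from the
  closed disk and its exterior, and W serves only to check holomorphy across the arcs.\<close>

lemma square_integrable_symmetric_extension_constant:
  assumes "open W" and sub: "punctured_cdisk \<subseteq> W" and hol: "\<Phi> holomorphic_on W"
    and sym: "\<And>l::real. l \<noteq> 0 \<Longrightarrow> of_real l \<in> W \<Longrightarrow> of_real (1 / l) \<in> W \<Longrightarrow>
                \<Phi> (of_real (1 / l)) = cnj (\<Phi> (of_real l))"
    and fin: "(\<integral>\<^sup>+z\<in>ball 0 1. ennreal ((cmod (\<Phi> z))\<^sup>2) \<partial>lborel) < \<infinity>"
  shows "\<exists>c. \<forall>z\<in>punctured_cdisk. \<Phi> z = c"
proof -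
  define E where "E z = (if cmod z \<le> 1 then \<Phi> z else cnj (\<Phi> (inverse (cnj z))))" for z
  have inW: "z \<in> W" if "cmod z \<le> 1" "z \<noteq> \<i>" "z \<noteq> - \<i>" for z
    using that sub by (auto simp: punctured_cdisk_def)
  have disk: "ball 0 1 \<subseteq> W"
    by (auto intro!: inW)
  have hol_disk: "\<Phi> holomorphic_on ball 0 1"
    using hol disk by (rule holomorphic_on_subset)
  have E_diff: "E field_differentiable (at z)" if z: "z \<in> - {\<i>, - \<i>}" for z
  proof -
    consider "cmod z < 1" | "cmod z > 1" | "cmod z = 1" by linarith
    then show ?thesis
    proof cases
      case 1
      have "E holomorphic_on ball 0 1"
        by (rule holomorphic_transform[OF hol_disk]) (auto simp: E_def)
      then show ?thesis
        using 1 by (intro holomorphic_on_imp_differentiable_at) auto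
    next
      case 2
      have op: "open (- cball (0::complex) 1)" by auto
      have "(\<Phi> \<circ> inverse) holomorphic_on cnj ` (- cball 0 1)"
      proof (intro holomorphic_on_compose_gen[OF _ hol_disk] holomorphic_intros)
        show "inverse ` cnj ` (- cball 0 1) \<subseteq> ball 0 1"
          by (auto simp: norm_inverse inverse_less_1_iff)
      qed auto
      from holomorphic_on_compose_cnj_cnj[OF this op]
      have "E holomorphic_on - cball 0 1"
        by (rule holomorphic_transform) (auto simp: E_def)
      then show ?thesis
        using 2 op by (intro holomorphic_on_imp_differentiable_at) auto
    next
      case 3
      have "Re z \<noteq> 0"
      proof
        assume "Re z = 0"
        then have "\<bar>Im z\<bar> = 1" using 3 by (simp add: cmod_def)
        then show False using z \<open>Re z = 0\<close> by (auto simp: complex_eq_iff abs_if split: if_splits)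
      qed
      \<comment> \<open>The arc containing z. Its real point is \<open>sgn (Re z)\<close>, which is
        1 or -1 because Re z \<noteq> 0.\<close>
      define A where "A = {w. cmod w = 1 \<and> 0 < sgn (Re z) * Re w}"
      have "A \<subseteq> sphere 0 1 \<inter> W"
        by (auto simp: A_def intro!: inW)
      moreover have "connected A"
        unfolding A_def using \<open>Re z \<noteq> 0\<close> by (intro connected_open_half_circle) (auto simp: sgn_eq_0_iff)
      moreover have "of_real (sgn (Re z)) \<in> A" "z \<in> A"
        using \<open>Re z \<noteq> 0\<close> 3 by (auto simp: A_def sgn_real_def)
      ultimately obtain \<epsilon> where \<epsilon>: "\<epsilon> > 0" "ball z \<epsilon> \<subseteq> W"
        "\<And>w. w \<in> ball z \<epsilon> \<Longrightarrow> \<Phi> w = cnj (\<Phi> (inverse (cnj w)))"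
        using reflection_identity_near_arc[OF \<open>open W\<close> hol sym, of A] by blast
      have "E holomorphic_on ball z \<epsilon>"
      proof (rule holomorphic_transform[OF holomorphic_on_subset[OF hol \<epsilon>(2)]])
        show "\<Phi> w = E w" if "w \<in> ball z \<epsilon>" for w
          unfolding E_def using \<epsilon>(3)[OF that] by simp
      qed
      then show ?thesis
        using \<epsilon>(1) by (intro holomorphic_on_imp_differentiable_at) auto
    qed
  qed
  have E_hol: "E holomorphic_on - {\<i>, - \<i>}"
    unfolding holomorphic_on_def using E_diff field_differentiable_at_within by blast

  define I where "I = enn2real (\<integral>\<^sup>+z\<in>ball 0 1. ennreal ((cmod (\<Phi> z))\<^sup>2) \<partial>lborel)"
  have I: "(\<integral>\<^sup>+z\<in>ball 0 1. ennreal ((cmod (\<Phi> z))\<^sup>2) \<partial>lborel) = ennreal I" "I \<ge> 0"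
    using fin by (simp_all add: I_def)
  \<comment> \<open>1 - |z| is the radius of the largest disk about z inside the unit disk.\<close>
  have local_bound: "ennreal (pi * ((1 - cmod z) * cmod (\<Phi> z))\<^sup>2)
      \<le> (\<integral>\<^sup>+w\<in>ball z (1 - cmod z). ennreal ((cmod (\<Phi> w))\<^sup>2) \<partial>lborel)"
    and local_sub: "ball z (1 - cmod z) \<subseteq> ball 0 1" if "cmod z < 1" for z
  proof -
    show *: "ball z (1 - cmod z) \<subseteq> ball 0 1"
      using that by (subst ball_subset_ball_iff) (auto simp: dist_norm)
    from square_norm_center_le_area_mean[OF holomorphic_on_subset[OF hol_disk *]] that
    show "ennreal (pi * ((1 - cmod z) * cmod (\<Phi> z))\<^sup>2)
      \<le> (\<integral>\<^sup>+w\<in>ball z (1 - cmod z). ennreal ((cmod (\<Phi> w))\<^sup>2) \<partial>lborel)"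
      by (simp add: power_mult_distrib mult.assoc)
  qed
  \<comment> \<open>Chosen so that pi * C^2 = I.\<close>
  define C where "C = sqrt (I / pi)"
  have "C \<ge> 0" using I by (simp add: C_def)
  have bound_in: "(1 - cmod z) * cmod (\<Phi> z) \<le> C" if "cmod z < 1" for z
  proof -
    note local_bound[OF that]
    also have "(\<integral>\<^sup>+w\<in>ball z (1 - cmod z). ennreal ((cmod (\<Phi> w))\<^sup>2) \<partial>lborel) \<le> ennreal I"
      unfolding I(1)[symmetric] using local_sub[OF that]
      by (intro nn_integral_mono mult_left_mono) (auto simp: indicator_def)
    finally have "pi * ((1 - cmod z) * cmod (\<Phi> z))\<^sup>2 \<le> I"
      using I(2) by (simp add: ennreal_le_iff)
    then have "((1 - cmod z) * cmod (\<Phi> z))\<^sup>2 \<le> I / pi"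
      by (simp add: field_simps)
    then show ?thesis unfolding C_def by (rule real_le_rsqrt)
  qed
  \<comment> \<open>Outside the disk |z| - 1 = |z| (1 - |w|) with w the reflected point, and |z| < 2
    costs a factor 2; passing from |z| - 1 to |z|^2 - 1 costs |z| + 1 < 3. Hence the 6. The range
    |z| < 2 covers the unit balls about \<i> and -\<i>.\<close>
  have E_bound: "cmod (E z) * \<bar>(cmod z)\<^sup>2 - 1\<bar> \<le> 6 * C" if "cmod z < 2" for z
  proof -
    have 1: "cmod (E z) * \<bar>cmod z - 1\<bar> \<le> 2 * C"
    proof (cases "cmod z" "1::real" rule: linorder_cases)
      case less
      then have "cmod (E z) * \<bar>cmod z - 1\<bar> = (1 - cmod z) * cmod (\<Phi> z)"
        by (simp add: E_def)
      also have "\<dots> \<le> 2 * C" using bound_in[OF less] \<open>C \<ge> 0\<close> by linarith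
      finally show ?thesis .
    next
      case greater
      define w where "w = inverse (cnj z)"
      have w: "cmod w = 1 / cmod z" by (simp add: w_def norm_inverse divide_inverse)
      then have "cmod w < 1" using greater by (simp add: divide_less_eq_1)
      have "z \<noteq> 0" using greater by auto
      have "cmod (E z) * \<bar>cmod z - 1\<bar> = cmod z * ((1 - cmod w) * cmod (\<Phi> w))"
        using greater \<open>z \<noteq> 0\<close> by (simp add: E_def w_def[symmetric]) (simp add: w field_simps)
      also have "\<dots> \<le> 2 * C"
        using bound_in[OF \<open>cmod w < 1\<close>] that \<open>cmod w < 1\<close> by (intro mult_mono) auto
      finally show ?thesis .
    qed (use \<open>C \<ge> 0\<close> in auto)
    have "cmod (E z) * \<bar>(cmod z)\<^sup>2 - 1\<bar> = (cmod (E z) * \<bar>cmod z - 1\<bar>) * (cmod z + 1)"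
    proof -
      have "(cmod z)\<^sup>2 - 1 = (cmod z - 1) * (cmod z + 1)"
        by (simp add: algebra_simps power2_eq_square)
      then show ?thesis by (simp add: abs_mult)
    qed
    also have "\<dots> \<le> (2 * C) * 3"
      by (rule mult_mono[OF 1]) (use that \<open>C \<ge> 0\<close> in auto)
    finally show ?thesis by simp
  qed
  have E_radial: "((\<lambda>r. (1 - r) * cmod (E (of_real r * p))) \<longlongrightarrow> 0) (at_left 1)" if p: "cmod p = 1" for p
  proof -
    define u where "u z = ennreal ((cmod (\<Phi> z))\<^sup>2) * indicator (ball 0 1) z" for z
    have "continuous_on (ball 0 1) (\<lambda>z. (cmod (\<Phi> z))\<^sup>2)"
      by (intro continuous_intros holomorphic_on_imp_continuous_on hol_disk)
    then have "(\<lambda>z. indicator (ball 0 1) z *\<^sub>R (cmod (\<Phi> z))\<^sup>2) \<in> borel_measurable borel"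
      by (intro borel_measurable_continuous_on_indicator) auto
    then have "(\<lambda>z. ennreal (indicator (ball 0 1) z *\<^sub>R (cmod (\<Phi> z))\<^sup>2)) \<in> borel_measurable borel"
      by measurable
    also have "(\<lambda>z. ennreal (indicator (ball 0 1) z *\<^sub>R (cmod (\<Phi> z))\<^sup>2)) = u"
      by (auto simp: u_def fun_eq_iff indicator_def)
    finally have u [measurable]: "u \<in> borel_measurable borel" .
    \<comment> \<open>The mass of |\<Phi>|^2 over the part of the disk within s of p. Continuity
      from above makes it tend to 0 with s.\<close>
    define m where "m s = emeasure (density lborel u) (ball p s)" for s
    have m: "m s = (\<integral>\<^sup>+z\<in>ball p s. u z \<partial>lborel)" for s
      unfolding m_def by (subst emeasure_density) auto
    have m_le: "ennreal (pi * ((1 - r) * cmod (E (of_real r * p)))\<^sup>2) \<le> m (2 * (1 - r))"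
      if r: "0 < r" "r < 1" for r
    proof -
      define z where "z = of_real r * p"
      have z: "cmod z = r" using p r by (simp add: z_def norm_mult)
      have "cmod (p - z) = 1 - r"
      proof -
        have "p - z = of_real (1 - r) * p" by (simp add: z_def algebra_simps)
        then show ?thesis using p r by (simp only: norm_mult norm_of_real) simp
      qed
      \<comment> \<open>The centre is at distance 1 - r from p and the radius is 1 - r as well,
        hence the factor 2.\<close>
      then have "ball z (1 - cmod z) \<subseteq> ball p (2 * (1 - r))"
        using r by (subst ball_subset_ball_iff) (auto simp: z dist_norm norm_minus_commute)
      moreover have "ball z (1 - cmod z) \<subseteq> ball 0 1"
        using local_sub[of z] z r by simp
      ultimately have "(\<integral>\<^sup>+w\<in>ball z (1 - cmod z). ennreal ((cmod (\<Phi> w))\<^sup>2) \<partial>lborel) \<le> m (2 * (1 - r))"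
        unfolding m u_def by (intro nn_integral_mono) (auto simp: indicator_def)
      then show ?thesis
        using local_bound[of z] z r by (auto simp: E_def z_def[symmetric])
    qed
    have "(\<lambda>n. m (1 / real (Suc n))) \<longlonglongrightarrow> emeasure (density lborel u) (\<Inter>n. ball p (1 / real (Suc n)))"
      unfolding m_def
    proof (rule Lim_emeasure_decseq)
      show "decseq (\<lambda>n. ball p (1 / real (Suc n)))"
        by (intro decseq_SucI subset_ball) (simp add: field_simps)
      show "emeasure (density lborel u) (ball p (1 / real (Suc n))) \<noteq> \<infinity>" for n
      proof -
        have "m (1 / real (Suc n)) \<le> (\<integral>\<^sup>+z. u z \<partial>lborel)"
          unfolding m by (intro nn_integral_mono) (auto simp: indicator_def)
        then show ?thesis using fin unfolding m_def u_def by (auto simp: top_unique)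
      qed
    qed auto
    also have "(\<Inter>n. ball p (1 / real (Suc n))) = {p}"
    proof (intro equalityI subsetI)
      fix z assume z: "z \<in> (\<Inter>n. ball p (1 / real (Suc n)))"
      show "z \<in> {p}"
      proof (rule ccontr)
        assume "z \<notin> {p}"
        then have "dist p z > 0" by auto
        then obtain n where "1 / real (Suc n) < dist p z"
          using nat_approx_posE by blast
        moreover have "dist p z < 1 / real (Suc n)" using z by auto
        ultimately show False by simp
      qed
    qed auto
    also have "emeasure (density lborel u) {p} = 0"
    proof -
      have "emeasure (density lborel u) {p} = (\<integral>\<^sup>+z. u z * indicator {p} z \<partial>lborel)"
        by (subst emeasure_density) auto
      also have "\<dots> = (\<integral>\<^sup>+z. 0 \<partial>(lborel :: complex measure))"
        using p by (intro nn_integral_cong) (auto simp: u_def indicator_def)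
      finally show ?thesis by simp
    qed
    finally have m0: "(\<lambda>n. m (1 / real (Suc n))) \<longlonglongrightarrow> 0" .
    show ?thesis
    proof (rule tendstoI)
      fix \<epsilon> :: real assume "\<epsilon> > 0"
      then have "0 < ennreal (pi * \<epsilon>\<^sup>2)" by simp
      from order_tendstoD(2)[OF m0 this] obtain n where n: "m (1 / real (Suc n)) < ennreal (pi * \<epsilon>\<^sup>2)"
        by (auto simp: eventually_sequentially)
      \<comment> \<open>The extra factor 2 in the denominator absorbs the 2 in the radius 2 * (1 -
        r).\<close>
      have "dist ((1 - r) * cmod (E (of_real r * p))) 0 < \<epsilon>" if r: "1 - 1 / (2 * real (Suc n)) < r" "r < 1" for r
      proof -
        have "1 / (2 * real (Suc n)) < 1"
          by (simp add: field_simps)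
        then have "r > 0" using r by linarith
        have "2 * (1 - r) \<le> 1 / real (Suc n)"
          using r by (simp add: field_simps)
        then have "m (2 * (1 - r)) \<le> m (1 / real (Suc n))"
          unfolding m_def by (intro emeasure_mono subset_ball) auto
        with m_le[OF \<open>r > 0\<close> r(2)] n
        have "ennreal (pi * ((1 - r) * cmod (E (of_real r * p)))\<^sup>2) < ennreal (pi * \<epsilon>\<^sup>2)"
          by (auto intro: le_less_trans)
        then have "((1 - r) * cmod (E (of_real r * p)))\<^sup>2 < \<epsilon>\<^sup>2"
          by (subst (asm) ennreal_less_iff) auto
        then have "(1 - r) * cmod (E (of_real r * p)) < \<epsilon>"
          using \<open>\<epsilon> > 0\<close> by (auto intro: power_less_imp_less_base)
        then show ?thesis using r by simp
      qed
      then show "\<forall>\<^sub>F r in at_left 1. dist ((1 - r) * cmod (E (of_real r * p))) 0 < \<epsilon>"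
        unfolding eventually_at_left_field
        by (intro exI[of _ "1 - 1 / (2 * real (Suc n))"]) auto
    qed
  qed
  \<comment> \<open>Radius 1 keeps the other singular point, at distance 2 from p, out of the
    ball.\<close>
  have lim: "((\<lambda>z. (z - p) * E z) \<longlongrightarrow> 0) (at p)" if "p \<in> {\<i>, - \<i>}" for p
  proof (rule removable_singularity_unit_circle[where \<rho> = 1 and C = "6 * C"])
    show p: "cmod p = 1" using that by auto
    have 2: "cmod z < 2" if "z \<in> ball p 1" for z
      using norm_triangle_ineq2[of z p] that p by (auto simp: dist_norm norm_minus_commute)
    have "ball p 1 - {p} \<subseteq> - {\<i>, - \<i>}"
      using that by (auto simp: dist_norm)
    then show "E holomorphic_on ball p 1 - {p}"
      by (rule holomorphic_on_subset[OF E_hol])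
    show "cmod (E z) * \<bar>(cmod z)\<^sup>2 - 1\<bar> \<le> 6 * C" if "z \<in> ball p 1 - {p}" for z
      using that by (intro E_bound 2) auto
    show "((\<lambda>r. (1 - r) * cmod (E (of_real r * p))) \<longlongrightarrow> 0) (at_left 1)"
      by (rule E_radial[OF p])
  qed auto
  have minus_ii: "\<i> \<in> interior (- {- \<i>})"
    by (subst interior_open) auto
  have set_eq: "- {- \<i>} - {\<i>} = - {\<i>, - \<i>}" by auto
  \<comment> \<open>The points are filled in one after the other: g crosses \<i> with -\<i> still
    missing, and h then crosses -\<i>, near which g and \<open>E\<close> agree.\<close>
  obtain g where g: "g holomorphic_on - {- \<i>}" "\<And>z. z \<notin> {\<i>, - \<i>} \<Longrightarrow> g z = E z"
    using holomorphic_on_extend_lim[OF _ minus_ii, of E] E_hol lim[of \<i>] unfolding set_eq by auto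
  have "((\<lambda>z. (z - (- \<i>)) * g z) \<longlongrightarrow> 0) (at (- \<i>))"
  proof (rule Lim_transform_within[OF lim[of "- \<i>"], of 1])
    show "(z - (- \<i>)) * E z = (z - (- \<i>)) * g z" if "0 < dist z (- \<i>)" "dist z (- \<i>) < 1" for z
      using that by (subst g(2)) (auto simp: dist_norm)
  qed auto
  then obtain h where h: "h holomorphic_on UNIV" "\<And>z. z \<noteq> - \<i> \<Longrightarrow> h z = g z"
    using holomorphic_on_extend_lim[of g UNIV "- \<i>"] g(1) by (auto simp: Compl_eq_Diff_UNIV)
  have hE: "h z = E z" if "z \<notin> {\<i>, - \<i>}" for z
    using that h(2) g(2) by auto
  have "bounded (range h)"
  proof -
    have "continuous_on (cball 0 2) h"
      by (rule holomorphic_on_imp_continuous_on[OF holomorphic_on_subset[OF h(1)]]) auto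
    then have "bounded (h ` cball 0 2)"
      by (intro compact_imp_bounded compact_continuous_image) auto
    then obtain B1 where B1: "\<And>z. cmod z \<le> 2 \<Longrightarrow> cmod (h z) \<le> B1"
      by (metis bounded_iff imageI mem_cball_0)
    \<comment> \<open>For |z| > 2 the reflected point lies within 1/2 of 0, so compactness bounds h
      near infinity too.\<close>
    have "continuous_on (cball 0 (1/2)) \<Phi>"
      by (rule holomorphic_on_imp_continuous_on[OF holomorphic_on_subset[OF hol_disk]]) auto
    then have "bounded (\<Phi> ` cball 0 (1/2))"
      by (intro compact_imp_bounded compact_continuous_image) auto
    then obtain B2 where B2: "\<And>z. cmod z \<le> 1/2 \<Longrightarrow> cmod (\<Phi> z) \<le> B2"
      by (metis bounded_iff imageI mem_cball_0)
    have "cmod (h z) \<le> max B1 B2" for z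
    proof (cases "cmod z \<le> 2")
      case False
      then have "z \<notin> {\<i>, - \<i>}" by auto
      have "cmod (h z) = cmod (\<Phi> (inverse (cnj z)))"
        using False hE[OF \<open>z \<notin> {\<i>, - \<i>}\<close>] by (simp add: E_def)
      also have "\<dots> \<le> B2"
      proof (rule B2)
        have "inverse (cmod z) \<le> inverse 2" using False by (intro le_imp_inverse_le) auto
        then show "cmod (inverse (cnj z)) \<le> 1/2" by (simp add: norm_inverse)
      qed
      finally show ?thesis by simp
    qed (use B1 in \<open>simp add: le_max_iff_disj\<close>)
    then show ?thesis by (auto simp: bounded_iff)
  qed
  then obtain c where c: "\<And>z. h z = c"
    using Liouville_theorem[OF h(1)] by (auto simp: constant_on_def)
  have "\<Phi> z = c" if "z \<in> punctured_cdisk" for z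
    using that hE[of z] c[of z] by (auto simp: punctured_cdisk_def E_def)
  then show ?thesis by blast
qed

section \<open>From constancy to the formula for the correlation\<close>

theorem theorem1p1:
  fixes f :: "real \<Rightarrow> complex" and U :: "complex set" and G :: "complex \<Rightarrow> complex"
  assumes "square_integrable f"
    and "holomorphic_extension (dilation_corr f) punctured_cdisk U G"
    and "(\<integral>\<^sup>+ z \<in> ball 0 1. ennreal ((cmod (G z))\<^sup>2 * cmod (z\<^sup>2 + 1)) \<partial>lebesgue) < \<infinity>"
  shows "\<exists>c0::real. c0 \<ge> 0 \<and>
           (\<forall>l::real. l \<noteq> 0 \<longrightarrow>
              dilation_corr f l = complex_of_real (c0 * (1 + l\<^sup>2) powr (- 1 / 2))) \<and>
           (c0 = 0 \<longrightarrow>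
              (\<forall>l::real. l \<noteq> 0 \<longrightarrow> dilation_corr f l = 0) \<and>
              (\<forall>z\<in>punctured_cdisk. G z = 0) \<and>
              (AE x in lebesgue. f x = 0))"
proof -
  have U: "open U" "punctured_cdisk \<subseteq> U" "G holomorphic_on U"
    and G: "\<And>l::real. l \<noteq> 0 \<Longrightarrow> of_real l \<in> U \<Longrightarrow> G (of_real l) = dilation_corr f l"
    using assms(2) by (auto simp: holomorphic_extension_def)
  define N where "N = (LINT x|lebesgue. (cmod (f x))\<^sup>2)"
  have "N \<ge> 0" by (simp add: N_def)
  \<comment> \<open>The part of U on which the principal root of 1 + z^2 is holomorphic. It keeps
    the punctured closed disk: if 1 + z^2 = t \<le> 0, then |z|^2 = 1 - t \<ge> 1, so in the closed
    disk t = 0 and z is \<i> or -\<i>.\<close>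
  define W where "W = U \<inter> (\<lambda>z. 1 + z\<^sup>2) -` (- \<real>\<^sub>\<le>\<^sub>0)"
  define \<Phi> where "\<Phi> z = G z * csqrt (1 + z\<^sup>2)" for z
  have \<Phi>_real: "\<Phi> (of_real l) = dilation_corr f l * of_real (sqrt (1 + l\<^sup>2))"
    if "l \<noteq> 0" "of_real l \<in> U" for l
  proof -
    have "csqrt (1 + (of_real l)\<^sup>2) = of_real (sqrt (1 + l\<^sup>2))"
      using csqrt_of_real_nonneg[of "1 + l\<^sup>2"] by simp
    then show ?thesis by (simp add: \<Phi>_def G that)
  qed
  have "\<exists>c. \<forall>z\<in>punctured_cdisk. \<Phi> z = c"
  proof (rule square_integrable_symmetric_extension_constant[where W = W])
    show "open W"
      unfolding W_def by (intro continuous_open_vimage open_Int U) (auto intro!: continuous_intros)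
    show "punctured_cdisk \<subseteq> W"
    proof
      fix z assume z: "z \<in> punctured_cdisk"
      have "1 + z\<^sup>2 \<notin> \<real>\<^sub>\<le>\<^sub>0"
      proof
        assume "1 + z\<^sup>2 \<in> \<real>\<^sub>\<le>\<^sub>0"
        then obtain t where t: "1 + z\<^sup>2 = of_real t" "t \<le> 0"
          by (auto elim: nonpos_Reals_cases)
        have z2: "z\<^sup>2 = of_real (t - 1)" using t(1) by (simp add: algebra_simps)
        have "(cmod z)\<^sup>2 = \<bar>t - 1\<bar>"
          by (simp only: norm_power[symmetric] z2 norm_of_real)
        moreover have "(cmod z)\<^sup>2 \<le> 1"
          using z by (auto simp: punctured_cdisk_def power_le_one)
        ultimately have "t = 0" using t(2) by linarith
        then have "z\<^sup>2 = \<i>\<^sup>2" using z2 by simp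
        then have "z = \<i> \<or> z = - \<i>" by (simp only: power2_eq_iff)
        then show False using z by (auto simp: punctured_cdisk_def)
      qed
      then show "z \<in> W" using z U by (auto simp: W_def)
    qed
    show "\<Phi> holomorphic_on W"
      unfolding \<Phi>_def W_def by (intro holomorphic_intros holomorphic_on_subset[OF U(3)]) auto
    show "\<Phi> (of_real (1 / l)) = cnj (\<Phi> (of_real l))"
      if l: "l \<noteq> 0" "of_real l \<in> W" "of_real (1 / l) \<in> W" for l :: real
    proof -
      have "sqrt (1 + (1 / l)\<^sup>2) = sqrt ((1 + l\<^sup>2) / l\<^sup>2)"
        using l by (simp add: field_simps)
      also have "\<dots> = sqrt (1 + l\<^sup>2) / \<bar>l\<bar>"
        by (simp add: real_sqrt_divide)
      finally have "\<bar>l\<bar> * sqrt (1 + (1 / l)\<^sup>2) = sqrt (1 + l\<^sup>2)"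
        using l by simp
      then have "\<Phi> (of_real (1 / l)) = cnj (dilation_corr f l) * of_real (sqrt (1 + l\<^sup>2))"
        using l by (subst \<Phi>_real) (auto simp: W_def dilation_corr_inverse scaleR_conv_of_real mult_ac
            simp flip: of_real_mult)
      also have "\<dots> = cnj (\<Phi> (of_real l))"
        using l by (subst \<Phi>_real) (auto simp: W_def)
      finally show ?thesis .
    qed
    have "(cmod (\<Phi> z))\<^sup>2 = (cmod (G z))\<^sup>2 * cmod (z\<^sup>2 + 1)" for z
      by (simp add: \<Phi>_def norm_mult power_mult_distrib norm_power[symmetric] add.commute)
    then show "(\<integral>\<^sup>+z\<in>ball 0 1. ennreal ((cmod (\<Phi> z))\<^sup>2) \<partial>lborel) < \<infinity>"
      using assms(3) by (simp add: nn_integral_completion)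
  qed
  then obtain c where c: "\<And>z. z \<in> punctured_cdisk \<Longrightarrow> \<Phi> z = c" by blast
  have real_disk: "of_real l \<in> punctured_cdisk" if "\<bar>l\<bar> \<le> 1" for l :: real
    using that by (auto simp: punctured_cdisk_def complex_eq_iff)
  define c0 where "c0 = sqrt 2 * N"
  have "c = \<Phi> (of_real 1)" using c real_disk[of 1] by simp
  also have "\<dots> = dilation_corr f 1 * of_real (sqrt (1 + 1\<^sup>2))"
    using real_disk[of 1] U(2) by (intro \<Phi>_real) auto
  finally have c_eq: "c = of_real c0"
    by (simp add: dilation_corr_1 c0_def N_def mult.commute)
  have small: "dilation_corr f l = of_real (c0 / sqrt (1 + l\<^sup>2))" if l: "l \<noteq> 0" "\<bar>l\<bar> \<le> 1" for l
  proof -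
    have "1 + l\<^sup>2 > 0" by (simp add: add_pos_nonneg)
    have "dilation_corr f l * of_real (sqrt (1 + l\<^sup>2)) = of_real c0"
      using c[OF real_disk[OF l(2)]] \<Phi>_real[of l] real_disk[OF l(2)] U(2) l c_eq by auto
    then show ?thesis
      using \<open>1 + l\<^sup>2 > 0\<close> by (simp add: field_simps del: of_real_add of_real_power)
  qed
  \<comment> \<open>A real l with |l| > 1 need not lie in U, so the formula is carried there from
    1/l by the inversion rule.\<close>
  have all: "dilation_corr f l = of_real (c0 / sqrt (1 + l\<^sup>2))" if l: "l \<noteq> 0" for l
  proof (cases "\<bar>l\<bar> \<le> 1")
    case False
    define k where "k = 1 / l"
    have k: "k \<noteq> 0" "\<bar>k\<bar> \<le> 1" "l = 1 / k" using False by (auto simp: k_def)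
    have "sqrt (1 + l\<^sup>2) = sqrt ((1 + k\<^sup>2) / k\<^sup>2)"
      unfolding k(3) using k(1) by (simp add: field_simps)
    also have "\<dots> = sqrt (1 + k\<^sup>2) / \<bar>k\<bar>"
      by (simp add: real_sqrt_divide)
    finally have "c0 / sqrt (1 + l\<^sup>2) = \<bar>k\<bar> * (c0 / sqrt (1 + k\<^sup>2))"
      by simp
    then show ?thesis
      using dilation_corr_inverse[OF k(1), of f] small[OF k(1,2)] k(3)
      by (simp add: scaleR_conv_of_real)
  qed (use small l in auto)
  have powr_eq: "(1 + l\<^sup>2) powr (- 1 / 2) = 1 / sqrt (1 + l\<^sup>2)" for l :: real
  proof -
    have "1 + l\<^sup>2 > 0" by (simp add: add_pos_nonneg)
    then show ?thesis by (simp add: powr_minus_divide powr_half_sqrt)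
  qed
  show ?thesis
  proof (intro exI[of _ c0] conjI impI allI ballI)
    show "c0 \<ge> 0" using \<open>N \<ge> 0\<close> by (simp add: c0_def)
    show "dilation_corr f l = of_real (c0 * (1 + l\<^sup>2) powr (- 1 / 2))" if "l \<noteq> 0" for l
      using all[OF that] powr_eq[of l] by simp
    assume "c0 = 0"
    then show "dilation_corr f l = 0" if "l \<noteq> 0" for l
      using all[OF that] by simp
    show "G z = 0" if z: "z \<in> punctured_cdisk" for z
    proof -
      have "1 + z\<^sup>2 \<noteq> 0"
      proof
        assume "1 + z\<^sup>2 = 0"
        then have "z\<^sup>2 = \<i>\<^sup>2" by (simp add: add_eq_0_iff)
        then have "z = \<i> \<or> z = - \<i>" by (simp only: power2_eq_iff)
        then show False using z by (auto simp: punctured_cdisk_def)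
      qed
      then show ?thesis
        using c[OF z] c_eq \<open>c0 = 0\<close> by (simp add: \<Phi>_def)
    qed
    have "N = 0" using \<open>c0 = 0\<close> by (simp add: c0_def)
    moreover have "integrable lebesgue (\<lambda>x. (cmod (f x))\<^sup>2)"
      using assms(1) by (simp add: square_integrable_def)
    ultimately show "AE x in lebesgue. f x = 0"
      using integral_nonneg_eq_0_iff_AE[of lebesgue "\<lambda>x. (cmod (f x))\<^sup>2"] by (simp add: N_def)
  qed
qed

end
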